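(* Let $H=(V,E)$ be a hypergraph and let $x\in\mathbb{R}^{|E|}$. Let $S\subset V$, let $t\in V-S$, and let $S'=S\cup\{t\}$. If $x(S)>|S|-1$ and $x(S:\{t\})\ge 1$, then $x(S')>|S'|-1$.
   Context: A hypergraph $H=(V,E)$ consists of a finite set $V$ of vertices and a set $E$ of edges, each edge $e\in E$ being a subset $e\subseteq V$ with $|e|\ge 2$. A vector $x\in\mathbb{R}^{|E|}$ has one coordinate $x_e$ per edge $e\in E$. For $S\subseteq V$, define $$x(S)=\sum_{e\in E}\max(|e\cap S|-1,\,0)\,x_e .$$ For $S,T\subseteq V$ with $S\cap T=\emptyset$, define $(S:T)=\{e\in E : e\cap S\ne\emptyset \text{ and } e\cap T\neq\emptyset\}$ and $x(S:T)=\sum_{e\in(S:T)}x_e$. The notation $S\subset V$ means proper subset. *)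

theory Defs
  imports Complex_Main
begin

locale hypergraph =
  fixes V :: "'v set" and E :: "'v set set"
  assumes finite_vertices: "finite V"
    and edge_subset: "e \<in> E \<Longrightarrow> e \<subseteq> V"
    and edge_card: "e \<in> E \<Longrightarrow> card e \<ge> 2"

text \<open>
  A vector indexed by the edges is a function on vertex sets of which only the values
  on \<open>E\<close> matter: both sums below range over subsets of \<open>E\<close>.
\<close>

definition induced_weight :: "'v set set \<Rightarrow> ('v set \<Rightarrow> real) \<Rightarrow> 'v set \<Rightarrow> real" where
  "induced_weight E x S = (\<Sum>e\<in>E. max (real (card (e \<inter> S)) - 1) 0 * x e)"

text \<open>The edge set \<open>(S:T)\<close>; only meant for disjoint \<open>S\<close> and \<open>T\<close>.\<close>

definition edges_between :: "'v set set \<Rightarrow> 'v set \<Rightarrow> 'v set \<Rightarrow> 'v set set" where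
  "edges_between E S T = {e \<in> E. e \<inter> S \<noteq> {} \<and> e \<inter> T \<noteq> {}}"

definition weight_between :: "'v set set \<Rightarrow> ('v set \<Rightarrow> real) \<Rightarrow> 'v set \<Rightarrow> 'v set \<Rightarrow> real" where
  "weight_between E x S T = (\<Sum>e\<in>edges_between E S T. x e)"

end

theory Submission
  imports Defs
begin

text \<open>Adding \<open>t\<close> to \<open>S\<close> raises the coefficient of \<open>x e\<close>
  by exactly one if \<open>e\<close> contains \<open>t\<close> and already meets \<open>S\<close>,
  and leaves it unchanged otherwise. Hence \<open>induced_weight_insert\<close>: x(S') = x(S) +
  x(S:{t}), an identity valid for any signs of \<open>x\<close>. The bound itself grows by one, as
  \<open>t\<close> is new, and x(S:{t}) \<ge> 1 pays for that.\<close>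

lemma induced_weight_insert:
  assumes "finite E" and "finite S" and "t \<notin> S"
  shows "induced_weight E x (insert t S) = induced_weight E x S + weight_between E x S {t}"
proof -
  have "max (real (card (e \<inter> insert t S)) - 1) 0 * x e
      = max (real (card (e \<inter> S)) - 1) 0 * x e + (if e \<inter> S \<noteq> {} \<and> e \<inter> {t} \<noteq> {} then x e else 0)"
    for e
  proof (cases "e \<inter> S = {}")
    case True
    \<comment> \<open>The truncation at 0 acts here: gaining \<open>t\<close> moves the untruncated
      coefficient from -1 to at most 0, so both maxima are 0.\<close>
    then have "e \<inter> insert t S \<subseteq> {t}" by auto
    then have "card (e \<inter> insert t S) \<le> 1"
      using card_mono[of "{t}"] by fastforce
    with True show ?thesis by (simp add: max_def)
  next
    case False
    \<comment> \<open>Now the truncation is inactive before and after, so the coefficient counts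
      \<open>t\<close> fully.\<close>
    with \<open>finite S\<close> have "card (e \<inter> S) \<ge> 1"
      by (simp add: Suc_le_eq card_gt_0_iff)
    with False assms(2,3) show ?thesis
      by (cases "t \<in> e") (simp_all add: algebra_simps)
  qed
  then show ?thesis
    \<comment> \<open>Summed over \<open>E\<close>, the conditional terms become the sum over
      \<open>edges_between E S {t}\<close>.\<close>
    using \<open>finite E\<close>
    by (simp add: induced_weight_def weight_between_def edges_between_def
        sum.distrib sum.inter_filter)
qed

theorem theorem5p4:
  fixes V :: "'v set" and E :: "'v set set" and x :: "'v set \<Rightarrow> real"
    and S S' :: "'v set" and t :: 'v
  assumes "hypergraph V E"
    and "S \<subset> V"
    and "t \<in> V - S"
    and "S' = S \<union> {t}"
    and "induced_weight E x S > real (card S) - 1"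
    and "weight_between E x S {t} \<ge> 1"
  shows "induced_weight E x S' > real (card S') - 1"
proof -
  interpret hypergraph V E by fact
  have "finite E"
    by (rule finite_subset[of _ "Pow V"]) (auto dest: edge_subset simp: finite_vertices)
  moreover have "finite S"
    using assms(2) finite_vertices finite_subset by blast
  ultimately show ?thesis
    using assms(3-6) induced_weight_insert[of E S t x] by simp
qed

end
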